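(* Let $\mathcal{H}$ be a Hilbert space, $T\in B(\mathcal{H})$ a bounded operator, $X$ a nonempty set, and $\varphi\colon X\to B(\mathcal{H})$ a map. The following are equivalent: (1) for every integer $n\geq 1$, all $\xi_1,\ldots,\xi_n\in\mathcal{H}$ and all $\eta_1,\ldots,\eta_n\in\mathcal{H}$, there exists $x\in X$ such that $$\sum_{i=1}^n\|\varphi(x)\,\xi_i-T\xi_i\|^2\leq\sum_{i=1}^n\|\varphi(x)\,\xi_i-\eta_i\|^2;$$ (2) $T\in\overline{\mathrm{conv}\{\varphi(x):x\in X\}}$, where the closure is with respect to the strong operator topology.
   Context: $B(\mathcal{H})$ denotes the algebra of bounded operators on $\mathcal{H}$, and $\mathrm{conv}$ denotes the convex hull (finite convex combinations). Hilbert spaces are complex. *)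

theory Defs
  imports "HOL-Analysis.Analysis"
begin

text \<open>
  Complex Hilbert spaces are layered on top of \<^class>\<open>real_inner\<close>: the underlying real
  structure is the restriction of scalars, with real inner product the real part of the
  complex one. Hence \<^const>\<open>norm\<close> is the norm of the complex inner product.
  The inner product is linear in its first argument.
\<close>

class complex_inner_space = real_inner +
  fixes scaleC :: "complex \<Rightarrow> 'a \<Rightarrow> 'a"
    and cinner :: "'a \<Rightarrow> 'a \<Rightarrow> complex"
  assumes scaleC_add_right: "scaleC c (x + y) = scaleC c x + scaleC c y"
    and scaleC_add_left: "scaleC (c + d) x = scaleC c x + scaleC d x"
    and scaleC_scaleC: "scaleC c (scaleC d x) = scaleC (c * d) x"
    and scaleC_one: "scaleC 1 x = x"
    and scaleR_eq_scaleC: "scaleR r x = scaleC (complex_of_real r) x"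
    and cinner_commute: "cinner x y = cnj (cinner y x)"
    and cinner_add_left: "cinner (x + y) z = cinner x z + cinner y z"
    and cinner_scaleC_left: "cinner (scaleC c x) y = c * cinner x y"
    and inner_eq_Re_cinner: "inner x y = Re (cinner x y)"

class complex_hilbert_space = complex_inner_space + complete_space

instantiation complex :: complex_hilbert_space
begin

definition scaleC_complex :: "complex \<Rightarrow> complex \<Rightarrow> complex"
  where "scaleC_complex c x = c * x"

definition cinner_complex :: "complex \<Rightarrow> complex \<Rightarrow> complex"
  where "cinner_complex x y = x * cnj y"

instance
  by standard
    (auto simp: scaleC_complex_def cinner_complex_def inner_complex_def algebra_simps
      scaleR_conv_of_real)

end

lemma norm_eq_sqrt_cinner: "norm x = sqrt (Re (cinner x x))"
  for x :: "'a::complex_inner_space"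
  by (simp add: norm_eq_sqrt_inner inner_eq_Re_cinner)

text \<open>
  \<open>'a \<Rightarrow>\<^sub>L 'a\<close> consists of the bounded real-linear maps, so the bounded operators of a
  complex Hilbert space are those that commute with complex scalars.
\<close>

definition bounded_operators :: "('a::complex_hilbert_space \<Rightarrow>\<^sub>L 'a) set"
  where "bounded_operators =
    {A. \<forall>c x. blinfun_apply A (scaleC c x) = scaleC c (blinfun_apply A x)}"

definition sot :: "('a::complex_hilbert_space \<Rightarrow>\<^sub>L 'a) topology"
  where "sot = subtopology strong_operator_topology bounded_operators"

end

theory Submission
  imports Defs
begin

text \<open>
  Put \<open>a\<^sub>i(S) = S \<xi>\<^sub>i - T \<xi>\<^sub>i\<close> and \<open>d\<^sub>i = \<eta>\<^sub>i - T \<xi>\<^sub>i\<close>. Expanding the squares turns the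
  inequality in (1) into \<open>2 \<Sum>\<^sub>i \<langle>a\<^sub>i(\<phi> x), d\<^sub>i\<rangle> \<le> \<Sum>\<^sub>i \<parallel>d\<^sub>i\<parallel>\<^sup>2\<close>. If it fails for every \<open>x\<close>, the
  reverse strict inequality bounds the affine functional \<open>S \<mapsto> \<Sum>\<^sub>i \<langle>a\<^sub>i(S), d\<^sub>i\<rangle>\<close> away from
  \<open>0\<close> on the convex hull, so \<open>T\<close> is not in the closure. Conversely, if \<open>T\<close> is not in the closure,
  then for some \<open>\<xi>\<close> the tuples \<open>a(S)\<close> stay away from \<open>0\<close>; the point \<open>d\<close> of minimal norm in the
  closure of this convex set is nonzero and satisfies \<open>\<Sum>\<^sub>i \<langle>a\<^sub>i(\<phi> x), d\<^sub>i\<rangle> \<ge> \<Sum>\<^sub>i \<parallel>d\<^sub>i\<parallel>\<^sup>2\<close>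
  for all \<open>x\<close>, which violates (1).
\<close>

section \<open>Geometry of finite tuples in an inner product space\<close>

lemma norm_diff_le_iff_inner:
  fixes a b t :: "'i \<Rightarrow> 'b::real_inner"
  shows "(\<Sum>i\<in>I. (norm (a i - t i))\<^sup>2) \<le> (\<Sum>i\<in>I. (norm (a i - b i))\<^sup>2) \<longleftrightarrow>
    2 * (\<Sum>i\<in>I. (a i - t i) \<bullet> (b i - t i)) \<le> (\<Sum>i\<in>I. (norm (b i - t i))\<^sup>2)"
proof -
  have "(norm (a i - b i))\<^sup>2 =
      (norm (a i - t i))\<^sup>2 - 2 * ((a i - t i) \<bullet> (b i - t i)) + (norm (b i - t i))\<^sup>2" for i
    by (simp add: power2_norm_eq_inner inner_diff_left inner_diff_right inner_commute)
  then show ?thesis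
    by (simp add: sum.distrib sum_subtractf sum_distrib_left)
qed

text \<open>Parallelogram law: convexity puts the midpoint of \<open>u k\<close> and
  \<open>u l\<close> in \<open>K\<close>, so its squared norm is at least \<delta>. This forces the
  squared norm of the difference to be small once those of \<open>u k\<close> and \<open>u l\<close>
  are near \<delta>, and each coordinate is dominated by the sum.\<close>

lemma minimizing_sequence_Cauchy:
  fixes K :: "('i \<Rightarrow> 'b::real_inner) set" and u :: "nat \<Rightarrow> 'i \<Rightarrow> 'b"
  assumes "finite I" "i \<in> I"
    and conv: "\<And>v w s. v \<in> K \<Longrightarrow> w \<in> K \<Longrightarrow> 0 \<le> s \<Longrightarrow> s \<le> 1
      \<Longrightarrow> (\<lambda>i. (1 - s) *\<^sub>R v i + s *\<^sub>R w i) \<in> K"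
    and lower: "\<And>v. v \<in> K \<Longrightarrow> \<delta> \<le> (\<Sum>i\<in>I. (norm (v i))\<^sup>2)"
    and u: "\<And>k. u k \<in> K" "(\<lambda>k. \<Sum>i\<in>I. (norm (u k i))\<^sup>2) \<longlonglongrightarrow> \<delta>"
  shows "Cauchy (\<lambda>k. u k i)"
proof (rule metric_CauchyI)
  fix e :: real assume "e > 0"
  let ?Q = "\<lambda>v. \<Sum>i\<in>I. (norm (v i))\<^sup>2"
  \<comment> \<open>The slack is tuned to the parallelogram law: 4 * (\<delta> + e^2/4) - 4 *
    \<delta> = e^2.\<close>
  have "eventually (\<lambda>k. ?Q (u k) < \<delta> + e\<^sup>2 / 4) sequentially"
    using u(2) \<open>e > 0\<close> by (intro order_tendstoD) auto
  then obtain N where N: "\<And>k. k \<ge> N \<Longrightarrow> ?Q (u k) < \<delta> + e\<^sup>2 / 4"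
    by (auto simp: eventually_sequentially)
  have "dist (u k i) (u l i) < e" if "k \<ge> N" "l \<ge> N" for k l
  proof -
    let ?mid = "\<lambda>i. (1 - 1/2) *\<^sub>R u k i + (1/2) *\<^sub>R u l i"
    have "\<delta> \<le> ?Q ?mid"
      using u(1) by (intro lower conv) auto
    moreover have "(norm (u k j - u l j))\<^sup>2 =
        2 * (norm (u k j))\<^sup>2 + 2 * (norm (u l j))\<^sup>2 - 4 * (norm (?mid j))\<^sup>2" for j
      by (simp add: power2_norm_eq_inner inner_simps inner_commute algebra_simps)
    then have "?Q (\<lambda>j. u k j - u l j) = 2 * ?Q (u k) + 2 * ?Q (u l) - 4 * ?Q ?mid"
      by (simp add: sum.distrib sum_subtractf sum_distrib_left)
    moreover have "(norm (u k i - u l i))\<^sup>2 \<le> ?Q (\<lambda>j. u k j - u l j)"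
      using assms(1,2) by (intro member_le_sum) auto
    ultimately have "(norm (u k i - u l i))\<^sup>2 < e\<^sup>2"
      using N[OF that(1)] N[OF that(2)] by linarith
    then show ?thesis
      using \<open>e > 0\<close> by (simp add: dist_norm power2_less_imp_less)
  qed
  then show "\<exists>N. \<forall>k\<ge>N. \<forall>l\<ge>N. dist (u k i) (u l i) < e" by blast
qed

text \<open>Projection of 0 onto the closure of \<open>K\<close>, carried out on tuples with the
  squared norm summed over \<open>I\<close>. Since \<open>K\<close> need not be closed,
  \<open>m\<close> is only a coordinatewise limit of a minimizing sequence; the last conclusion is
  the variational inequality at that limit.\<close>

lemma minimal_norm_point:
  fixes K :: "('i \<Rightarrow> 'b::{real_inner,complete_space}) set"
  assumes I: "finite I" and "K \<noteq> {}"
    and conv: "\<And>v w s. v \<in> K \<Longrightarrow> w \<in> K \<Longrightarrow> 0 \<le> s \<Longrightarrow> s \<le> 1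
      \<Longrightarrow> (\<lambda>i. (1 - s) *\<^sub>R v i + s *\<^sub>R w i) \<in> K"
    and lower: "\<And>v. v \<in> K \<Longrightarrow> \<epsilon> \<le> (\<Sum>i\<in>I. (norm (v i))\<^sup>2)"
  obtains m where "\<epsilon> \<le> (\<Sum>i\<in>I. (norm (m i))\<^sup>2)"
    and "\<And>v. v \<in> K \<Longrightarrow> (\<Sum>i\<in>I. (norm (m i))\<^sup>2) \<le> (\<Sum>i\<in>I. v i \<bullet> m i)"
proof -
  define Q where "Q v = (\<Sum>i\<in>I. (norm (v i))\<^sup>2)" for v :: "'i \<Rightarrow> 'b"
  define \<delta> where "\<delta> = (INF v\<in>K. Q v)"
  have bdd: "bdd_below (Q ` K)"
    using lower by (auto simp: Q_def intro!: bdd_belowI2)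
  have \<delta>_le: "\<delta> \<le> Q v" if "v \<in> K" for v
    unfolding \<delta>_def using bdd that by (rule cINF_lower)
  have "\<exists>v\<in>K. Q v < \<delta> + inverse (real (Suc k))" for k
    using cINF_less_iff[OF \<open>K \<noteq> {}\<close> bdd, of "\<delta> + inverse (real (Suc k))"]
    by (simp add: \<delta>_def)
  then obtain u where u: "\<And>k. u k \<in> K" "\<And>k. Q (u k) < \<delta> + inverse (real (Suc k))"
    by metis
  have lim: "(\<lambda>k. Q (u k)) \<longlonglongrightarrow> \<delta>"
  proof (rule tendsto_sandwich)
    show "eventually (\<lambda>k. \<delta> \<le> Q (u k)) sequentially"
      using u(1) \<delta>_le by simp
    show "eventually (\<lambda>k. Q (u k) \<le> \<delta> + inverse (real (Suc k))) sequentially"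
      using u(2) by (intro always_eventually allI less_imp_le)
    show "(\<lambda>k. \<delta> + inverse (real (Suc k))) \<longlonglongrightarrow> \<delta>"
      using tendsto_add[OF tendsto_const LIMSEQ_inverse_real_of_nat, of \<delta>] by simp
  qed simp
  \<comment> \<open>Convergence is shown only for indices in \<open>I\<close>; other values of
    \<open>m\<close> may be arbitrary, as all sums run over \<open>I\<close>.\<close>
  define m where "m i = lim (\<lambda>k. u k i)" for i
  have m: "(\<lambda>k. u k i) \<longlonglongrightarrow> m i" if "i \<in> I" for i
  proof -
    have "Cauchy (\<lambda>k. u k i)"
      by (rule minimizing_sequence_Cauchy[OF I that conv \<delta>_le[unfolded Q_def] u(1) lim[unfolded Q_def]])
    then have "convergent (\<lambda>k. u k i)"
      by (rule Cauchy_convergent)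
    then show ?thesis
      unfolding m_def by (rule convergent_LIMSEQ_iff[THEN iffD1])
  qed
  have "(\<lambda>k. Q (u k)) \<longlonglongrightarrow> Q m"
    unfolding Q_def by (intro tendsto_intros m)
  then have Qm: "Q m = \<delta>"
    using lim LIMSEQ_unique by blast
  have "Q m \<le> (\<Sum>i\<in>I. v i \<bullet> m i)" if "v \<in> K" for v
  proof -
    define D where "D = (\<Sum>i\<in>I. m i \<bullet> (v i - m i))"
    define q where "q = Q (\<lambda>i. v i - m i)"
    \<comment> \<open>Moving from \<open>m\<close> towards \<open>v\<close> changes the squared norm
      by s * (2 * D + s * q). As \<open>m\<close> may lie outside \<open>K\<close>, the lower bound
      \<delta> is applied on the segments from \<open>u k\<close> to \<open>v\<close> and passed to
      the limit; then s > 0 is divided out.\<close>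
    have "0 \<le> 2 * D + s * q" if s: "0 < s" "s \<le> 1" for s
    proof -
      have "(\<lambda>k. Q (\<lambda>i. (1 - s) *\<^sub>R u k i + s *\<^sub>R v i)) \<longlonglongrightarrow> Q (\<lambda>i. (1 - s) *\<^sub>R m i + s *\<^sub>R v i)"
        unfolding Q_def by (intro tendsto_intros m)
      moreover have "\<delta> \<le> Q (\<lambda>i. (1 - s) *\<^sub>R u k i + s *\<^sub>R v i)" for k
        using s by (intro \<delta>_le conv u(1) \<open>v \<in> K\<close>) auto
      ultimately have "\<delta> \<le> Q (\<lambda>i. (1 - s) *\<^sub>R m i + s *\<^sub>R v i)"
        by (intro LIMSEQ_le_const) auto
      moreover have "(norm ((1 - s) *\<^sub>R m i + s *\<^sub>R v i))\<^sup>2 = (norm (m i))\<^sup>2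
          + s * (2 * (m i \<bullet> (v i - m i)) + s * (norm (v i - m i))\<^sup>2)" for i
        by (simp add: power2_norm_eq_inner inner_simps inner_commute algebra_simps)
      then have "Q (\<lambda>i. (1 - s) *\<^sub>R m i + s *\<^sub>R v i) = Q m + s * (2 * D + s * q)"
        by (simp add: Q_def D_def q_def sum.distrib flip: sum_distrib_left)
      ultimately show ?thesis
        using Qm s by (simp add: zero_le_mult_iff)
    qed
    \<comment> \<open>Letting s tend to 0 from the right removes the quadratic term and leaves 0
      \<le> D.\<close>
    then have "eventually (\<lambda>s. 0 \<le> 2 * D + s * q) (at_right 0)"
      by (intro eventually_at_rightI[of 0 1]) auto
    moreover have "((\<lambda>s. 2 * D + s * q) \<longlongrightarrow> 2 * D + 0 * q) (at_right 0)"
      by (intro tendsto_intros)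
    ultimately have "0 \<le> 2 * D + 0 * q"
      by (intro tendsto_lowerbound) auto
    then have "0 \<le> D" by simp
    then show ?thesis
      by (simp add: D_def Q_def inner_diff_right sum_subtractf power2_norm_eq_inner inner_commute)
  qed
  moreover have "\<epsilon> \<le> Q m"
    unfolding Qm \<delta>_def using \<open>K \<noteq> {}\<close> lower by (intro cINF_greatest) (auto simp: Q_def)
  ultimately show thesis
    by (intro that[of m]) (auto simp: Q_def)
qed

section \<open>Strong operator closure as approximation on finite sets of vectors\<close>

lemma strong_operator_topology_nhd:
  fixes T :: "'a::real_normed_vector \<Rightarrow>\<^sub>L 'b::real_normed_vector"
  assumes "openin strong_operator_topology U" "T \<in> U"
  obtains F e where "finite F" "e > 0"
    "\<And>S. (\<And>\<xi>. \<xi> \<in> F \<Longrightarrow> norm (blinfun_apply S \<xi> - T \<xi>) < e) \<Longrightarrow> S \<in> U"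
proof -
  obtain V where V: "open V" "U = blinfun_apply -` V"
    using assms(1) by (auto simp: strong_operator_topology_def openin_pullback_topology)
  obtain W where W: "blinfun_apply T \<in> Pi\<^sub>E UNIV W" "\<And>\<xi>. open (W \<xi>)"
      "finite {\<xi>. W \<xi> \<noteq> UNIV}" "Pi\<^sub>E UNIV W \<subseteq> V"
    using product_topology_open_contains_basis[of "\<lambda>_. euclidean" UNIV V "blinfun_apply T"]
      V assms(2) by (auto simp: open_fun_def)
  \<comment> \<open>The topology is pulled back from the product topology on functions, whose basic
    open boxes restrict only finitely many coordinates; \<open>F\<close> collects these.\<close>
  define F where "F = {\<xi>. W \<xi> \<noteq> UNIV}"
  have "\<exists>e>0. ball (T \<xi>) e \<subseteq> W \<xi>" for \<xi>
    using W(1,2) by (meson PiE_mem UNIV_I open_contains_ball)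
  then obtain e where e: "\<And>\<xi>. e \<xi> > 0" "\<And>\<xi>. ball (T \<xi>) (e \<xi>) \<subseteq> W \<xi>"
    by metis
  \<comment> \<open>One radius for all of \<open>F\<close>; inserting 1 keeps the minimum meaningful
    when \<open>F\<close> is empty.\<close>
  define r where "r = Min (insert 1 (e ` F))"
  have "finite F" using W(3) by (simp add: F_def)
  then have r: "r > 0" "\<And>\<xi>. \<xi> \<in> F \<Longrightarrow> r \<le> e \<xi>"
    using e(1) by (auto simp: r_def)
  have "S \<in> U" if S: "\<And>\<xi>. \<xi> \<in> F \<Longrightarrow> norm (S \<xi> - T \<xi>) < r" for S :: "'a \<Rightarrow>\<^sub>L 'b"
  proof -
    have "S \<xi> \<in> W \<xi>" for \<xi>
    proof (cases "\<xi> \<in> F")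
      case True
      then have "S \<xi> \<in> ball (T \<xi>) (e \<xi>)"
        using S[OF True] r(2)[OF True] by (simp add: dist_norm norm_minus_commute)
      then show ?thesis using e(2) by blast
    qed (auto simp: F_def)
    then show ?thesis using W(4) V(2) by auto
  qed
  then show thesis using that \<open>finite F\<close> r(1) by blast
qed

text \<open>Brings (2) into a form that matches the finite tuples of (1). As \<open>T\<close> and
  \<open>C\<close> lie among the complex-linear operators, closure in the subspace topology
  \<open>sot\<close> reduces to closure in the ambient one.\<close>

lemma in_closure_of_sot_iff:
  assumes "T \<in> bounded_operators" "C \<subseteq> bounded_operators"
  shows "T \<in> sot closure_of C \<longleftrightarrow>
    (\<forall>F e. finite F \<longrightarrow> e > 0 \<longrightarrow> (\<exists>S\<in>C. \<forall>\<xi>\<in>F. norm (S \<xi> - T \<xi>) < e))"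
proof -
  have "bounded_operators \<inter> C = C" using assms(2) by blast
  then have *: "T \<in> sot closure_of C \<longleftrightarrow> T \<in> strong_operator_topology closure_of C"
    using assms(1) by (simp add: sot_def closure_of_subtopology)
  show ?thesis unfolding *
  proof safe
    fix F :: "'a set" and e :: real
    assume T: "T \<in> strong_operator_topology closure_of C" and "finite F" "e > 0"
    define U where "U = {S. \<forall>\<xi>\<in>F. blinfun_apply S \<xi> \<in> ball (T \<xi>) e}"
    have "openin strong_operator_topology U"
      unfolding U_def using \<open>finite F\<close> by (rule strong_operator_topology_basis) simp
    moreover have "T \<in> U"
      using \<open>e > 0\<close> by (simp add: U_def)
    ultimately obtain S where "S \<in> C" "S \<in> U"
      using T unfolding in_closure_of by blast
    then show "\<exists>S\<in>C. \<forall>\<xi>\<in>F. norm (S \<xi> - T \<xi>) < e"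
      by (auto simp: U_def dist_norm norm_minus_commute)
  next
    assume approx: "\<forall>F e. finite F \<longrightarrow> e > 0 \<longrightarrow> (\<exists>S\<in>C. \<forall>\<xi>\<in>F. norm (S \<xi> - T \<xi>) < e)"
    have "\<exists>S. S \<in> C \<and> S \<in> U" if U: "T \<in> U" "openin strong_operator_topology U" for U
    proof -
      obtain F e where "finite F" "e > 0"
        and F: "\<And>S. (\<And>\<xi>. \<xi> \<in> F \<Longrightarrow> norm (blinfun_apply S \<xi> - T \<xi>) < e) \<Longrightarrow> S \<in> U"
        using strong_operator_topology_nhd[OF U(2,1)] by blast
      then obtain S where "S \<in> C" "\<forall>\<xi>\<in>F. norm (S \<xi> - T \<xi>) < e"
        using approx by blast
      then show ?thesis
        using F by blast
    qed
    then show "T \<in> strong_operator_topology closure_of C"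
      by (simp add: in_closure_of strong_operator_topology_topspace)
  qed
qed

lemma convex_bounded_operators: "convex bounded_operators"
proof -
  have "r *\<^sub>R scaleC c x = scaleC c (r *\<^sub>R x)" for r c and x :: "'a::complex_hilbert_space"
    by (simp add: scaleR_eq_scaleC scaleC_scaleC mult.commute)
  then show ?thesis
    by (auto simp: convex_def bounded_operators_def blinfun.bilinear_simps scaleC_add_right)
qed

section \<open>The two implications for one finite family of vectors\<close>

lemma condition_if_approximable:
  fixes T :: "'a::real_normed_vector \<Rightarrow>\<^sub>L 'b::real_inner"
    and \<phi> :: "'x \<Rightarrow> 'a \<Rightarrow>\<^sub>L 'b"
  assumes "finite I" "X \<noteq> {}"
    and approx: "\<And>e. e > 0 \<Longrightarrow> \<exists>S\<in>convex hull (\<phi> ` X). \<forall>i\<in>I. norm (blinfun_apply S (\<xi> i) - T (\<xi> i)) < e"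
  shows "\<exists>x\<in>X. (\<Sum>i\<in>I. (norm (\<phi> x (\<xi> i) - T (\<xi> i)))\<^sup>2) \<le> (\<Sum>i\<in>I. (norm (\<phi> x (\<xi> i) - \<eta> i))\<^sup>2)"
proof (rule ccontr)
  define d where "d i = \<eta> i - T (\<xi> i)" for i
  define q where "q = (\<Sum>i\<in>I. (norm (d i))\<^sup>2)"
  define p where "p S = 2 * (\<Sum>i\<in>I. (S (\<xi> i) - T (\<xi> i)) \<bullet> d i)" for S :: "'a \<Rightarrow>\<^sub>L 'b"
  assume "\<not> ?thesis"
  then have less: "q < p (\<phi> x)" if "x \<in> X" for x
    using that norm_diff_le_iff_inner[of "\<lambda>i. \<phi> x (\<xi> i)" "\<lambda>i. T (\<xi> i)" I \<eta>]
    by (fastforce simp: q_def p_def d_def)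
  \<comment> \<open>Because s + t = 1, the term T (\<xi> i) splits along a convex combination, so
    \<open>p\<close> is affine and the bound passes from the operators \<phi> x to their
    hull.\<close>
  have "convex {S. q \<le> p S}"
  proof (rule convexI)
    fix S S' and s t :: real
    assume S: "S \<in> {S. q \<le> p S}" "S' \<in> {S. q \<le> p S}" and st: "0 \<le> s" "0 \<le> t" "s + t = 1"
    have "(s *\<^sub>R S + t *\<^sub>R S') (\<xi> i) - T (\<xi> i) =
        s *\<^sub>R (S (\<xi> i) - T (\<xi> i)) + t *\<^sub>R (S' (\<xi> i) - T (\<xi> i))" for i
      using st(3) scaleR_left.add[of s t "T (\<xi> i)"]
      by (simp add: blinfun.bilinear_simps scaleR_diff_right algebra_simps)
    then have "p (s *\<^sub>R S + t *\<^sub>R S') = s * p S + t * p S'"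
      by (simp add: p_def inner_add_left sum.distrib distrib_left mult.left_commute
          flip: sum_distrib_left)
    moreover have "s * q + t * q \<le> s * p S + t * p S'"
      using S st by (intro add_mono mult_left_mono) auto
    ultimately show "s *\<^sub>R S + t *\<^sub>R S' \<in> {S. q \<le> p S}"
      using st(3) by (simp flip: distrib_right)
  qed
  then have "convex hull (\<phi> ` X) \<subseteq> {S. q \<le> p S}"
    using less by (intro hull_minimal) (auto intro: less_imp_le)
  then have le: "q \<le> p S" if "S \<in> convex hull (\<phi> ` X)" for S
    using that by blast
  show False
  \<comment> \<open>For q = 0 the bound on the hull is compatible with small values of
    \<open>p\<close>. The contradiction then comes from the strict inequality \<open>less\<close> at
    a point of \<open>X\<close>, since \<open>p\<close> vanishes identically.\<close>
  proof (cases "q = 0")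
    case True
    then have "\<forall>i\<in>I. d i = 0"
      using \<open>finite I\<close> by (simp add: q_def sum_nonneg_eq_0_iff)
    then have "p S = 0" for S by (simp add: p_def)
    then show False using less \<open>X \<noteq> {}\<close> True by auto
  next
    case False
    then have "q > 0" by (simp add: q_def sum_nonneg less_le)
    define M where "M = (\<Sum>i\<in>I. norm (d i))"
    have "M \<ge> 0" by (simp add: M_def sum_nonneg)
    \<comment> \<open>By Cauchy-Schwarz an e-approximant satisfies p S \<le> 2 * e * M; the added 1
      makes this strictly less than q.\<close>
    define e where "e = q / (2 * (M + 1))"
    have "e > 0" using \<open>q > 0\<close> \<open>M \<ge> 0\<close> by (simp add: e_def)
    then obtain S where S: "S \<in> convex hull (\<phi> ` X)" "\<And>i. i \<in> I \<Longrightarrow> norm (blinfun_apply S (\<xi> i) - T (\<xi> i)) < e"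
      using approx by blast
    have "(S (\<xi> i) - T (\<xi> i)) \<bullet> d i \<le> e * norm (d i)" if "i \<in> I" for i
      using norm_cauchy_schwarz[of "S (\<xi> i) - T (\<xi> i)" "d i"]
        mult_right_mono[OF less_imp_le[OF S(2)[OF that]], of "norm (d i)"] by simp
    then have "p S \<le> 2 * (e * M)"
      unfolding p_def M_def sum_distrib_left[of e] by (intro mult_left_mono sum_mono) auto
    also have "\<dots> < 2 * (e * (M + 1))" using \<open>e > 0\<close> by simp
    also have "\<dots> = q" using \<open>M \<ge> 0\<close> by (simp add: e_def field_simps)
    finally show False using le[OF S(1)] by simp
  qed
qed

lemma approximable_if_condition:
  fixes T :: "'a::real_normed_vector \<Rightarrow>\<^sub>L 'b::{real_inner,complete_space}"
    and \<phi> :: "'x \<Rightarrow> 'a \<Rightarrow>\<^sub>L 'b"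
  assumes "finite I" "e > 0" "X \<noteq> {}"
    and cond: "\<And>\<eta>. \<exists>x\<in>X. (\<Sum>i\<in>I. (norm (\<phi> x (\<xi> i) - T (\<xi> i)))\<^sup>2)
      \<le> (\<Sum>i\<in>I. (norm (\<phi> x (\<xi> i) - \<eta> i))\<^sup>2)"
  shows "\<exists>S\<in>convex hull (\<phi> ` X). \<forall>i\<in>I. norm (blinfun_apply S (\<xi> i) - T (\<xi> i)) < e"
proof (rule ccontr)
  assume neg: "\<not> ?thesis"
  define g where "g S i = S (\<xi> i) - T (\<xi> i)" for S :: "'a \<Rightarrow>\<^sub>L 'b" and i
  define K where "K = g ` (convex hull (\<phi> ` X))"
  \<comment> \<open>Each operator in the hull misses \<open>T\<close> by at least \<open>e\<close>
    at some index, and that single term already contributes e^2.\<close>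
  have lower: "e\<^sup>2 \<le> (\<Sum>i\<in>I. (norm (v i))\<^sup>2)" if v: "v \<in> K" for v
  proof -
    obtain i where "i \<in> I" "e \<le> norm (v i)"
      using neg v by (force simp: K_def g_def not_less)
    then have "e\<^sup>2 \<le> (norm (v i))\<^sup>2" using \<open>e > 0\<close> by (intro power_mono) auto
    also have "\<dots> \<le> (\<Sum>i\<in>I. (norm (v i))\<^sup>2)"
      using \<open>i \<in> I\<close> \<open>finite I\<close> by (intro member_le_sum) auto
    finally show ?thesis .
  qed
  have conv: "(\<lambda>i. (1 - s) *\<^sub>R v i + s *\<^sub>R w i) \<in> K"
    if vw: "v \<in> K" "w \<in> K" and s: "0 \<le> s" "s \<le> 1" for v w s
  proof -
    obtain S S' where S: "S \<in> convex hull (\<phi> ` X)" "S' \<in> convex hull (\<phi> ` X)" "v = g S" "w = g S'"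
      using vw by (auto simp: K_def)
    have "(1 - s) *\<^sub>R S + s *\<^sub>R S' \<in> convex hull (\<phi> ` X)"
      using S s by (intro convexD[OF convex_convex_hull]) auto
    moreover have "(\<lambda>i. (1 - s) *\<^sub>R v i + s *\<^sub>R w i) = g ((1 - s) *\<^sub>R S + s *\<^sub>R S')"
      by (simp add: S g_def fun_eq_iff blinfun.bilinear_simps algebra_simps)
    ultimately show ?thesis by (auto simp: K_def)
  qed
  have "K \<noteq> {}" using \<open>X \<noteq> {}\<close> by (simp add: K_def)
  from minimal_norm_point[OF \<open>finite I\<close> this conv lower] obtain m where
    m: "e\<^sup>2 \<le> (\<Sum>i\<in>I. (norm (m i))\<^sup>2)"
      "\<And>v. v \<in> K \<Longrightarrow> (\<Sum>i\<in>I. (norm (m i))\<^sup>2) \<le> (\<Sum>i\<in>I. v i \<bullet> m i)"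
    by blast
  \<comment> \<open>The choice \<eta> i = T (\<xi> i) + m i makes the displacement exactly
    \<open>m\<close>. Together with the variational inequality, twice the squared norm of
    \<open>m\<close> is then at most that squared norm, although it is at least e^2 > 0.\<close>
  obtain x where x: "x \<in> X" "2 * (\<Sum>i\<in>I. g (\<phi> x) i \<bullet> m i) \<le> (\<Sum>i\<in>I. (norm (m i))\<^sup>2)"
    using cond[of "\<lambda>i. T (\<xi> i) + m i"] unfolding norm_diff_le_iff_inner by (auto simp: g_def)
  have "g (\<phi> x) \<in> K" using x(1) by (auto simp: K_def intro: hull_inc)
  from m(2)[OF this] x(2) m(1) \<open>e > 0\<close> show False
    using zero_less_power[of e 2] by linarith
qed

theorem theorem2p1:
  fixes T :: "'a::complex_hilbert_space \<Rightarrow>\<^sub>L 'a"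
    and X :: "'x set"
    and \<phi> :: "'x \<Rightarrow> 'a \<Rightarrow>\<^sub>L 'a"
  assumes "T \<in> bounded_operators"
    and "X \<noteq> {}"
    and "\<And>x. x \<in> X \<Longrightarrow> \<phi> x \<in> bounded_operators"
  shows "(\<forall>n\<ge>1. \<forall>(\<xi> :: nat \<Rightarrow> 'a) (\<eta> :: nat \<Rightarrow> 'a). \<exists>x\<in>X.
            (\<Sum>i=1..n. (norm (blinfun_apply (\<phi> x) (\<xi> i) - blinfun_apply T (\<xi> i)))\<^sup>2)
              \<le> (\<Sum>i=1..n. (norm (blinfun_apply (\<phi> x) (\<xi> i) - \<eta> i))\<^sup>2))
         \<longleftrightarrow> T \<in> sot closure_of (convex hull (\<phi> ` X))"
proof -
  have "convex hull (\<phi> ` X) \<subseteq> bounded_operators"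
    using assms(3) by (intro hull_minimal convex_bounded_operators) auto
  note closure_iff = in_closure_of_sot_iff[OF assms(1) this]
  show ?thesis
    unfolding closure_iff
  proof (intro iffI allI impI)
    fix F :: "'a set" and e :: real
    assume cond: "\<forall>n\<ge>1. \<forall>(\<xi> :: nat \<Rightarrow> 'a) (\<eta> :: nat \<Rightarrow> 'a). \<exists>x\<in>X.
            (\<Sum>i=1..n. (norm (blinfun_apply (\<phi> x) (\<xi> i) - blinfun_apply T (\<xi> i)))\<^sup>2)
              \<le> (\<Sum>i=1..n. (norm (blinfun_apply (\<phi> x) (\<xi> i) - \<eta> i))\<^sup>2)"
      and "finite F" "e > 0"
    \<comment> \<open>Inserting 0 secures n \<ge> 1, as (1) demands, even for empty
      \<open>F\<close>; approximating on the larger set also approximates on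
      \<open>F\<close>.\<close>
    define n where "n = card (insert 0 F)"
    have "n \<ge> 1"
      using \<open>finite F\<close> by (simp add: n_def Suc_le_eq card_gt_0_iff)
    obtain \<xi> where "bij_betw \<xi> {1..n} (insert 0 F)"
      using ex_bij_betw_nat_finite_1[of "insert 0 F"] \<open>finite F\<close> by (auto simp: n_def)
    then have F: "F \<subseteq> \<xi> ` {1..n}"
      by (auto dest: bij_betw_imp_surj_on)
    have "\<exists>S\<in>convex hull (\<phi> ` X). \<forall>i\<in>{1..n}. norm (blinfun_apply S (\<xi> i) - T (\<xi> i)) < e"
      using cond \<open>n \<ge> 1\<close> \<open>e > 0\<close> \<open>X \<noteq> {}\<close> by (intro approximable_if_condition) auto
    with F show "\<exists>S\<in>convex hull (\<phi> ` X). \<forall>\<xi>\<in>F. norm (S \<xi> - T \<xi>) < e"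
      by blast
  next
    fix n :: nat and \<xi> \<eta> :: "nat \<Rightarrow> 'a"
    assume approx: "\<forall>F e. finite F \<longrightarrow> e > 0 \<longrightarrow>
      (\<exists>S\<in>convex hull (\<phi> ` X). \<forall>\<xi>\<in>F. norm (S \<xi> - T \<xi>) < e)"
    show "\<exists>x\<in>X. (\<Sum>i=1..n. (norm (\<phi> x (\<xi> i) - T (\<xi> i)))\<^sup>2)
        \<le> (\<Sum>i=1..n. (norm (\<phi> x (\<xi> i) - \<eta> i))\<^sup>2)"
      using approx[rule_format, of "\<xi> ` {1..n}"] \<open>X \<noteq> {}\<close>
      by (intro condition_if_approximable) auto
  qed
qed

end
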